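(* For every $k\ge1$, the $k$-th Wu characteristic $\omega_k$ is a ring homomorphism from the strong ring to $\mathbb{Z}$.
   Context: A finite abstract simplicial complex is a finite set of finite non-empty sets which is closed under taking non-empty subsets; $\dim(x)=|x|-1$. A product complex is a finite Cartesian product $G_1\times\cdots\times G_n$ ($n\ge 1$) of finite abstract simplicial complexes; its cells are the sets $x=x_1\times\cdots\times x_n$ with $x_i\in G_i$, with $\dim(x)=\sum_i\dim(x_i)$ and $\omega(x)=(-1)^{\dim(x)}$. Two product complexes are isomorphic if there is a bijection between their cells preserving inclusion in both directions. A signed complex is a finite formal disjoint union of product complexes, each summand carrying a sign in $\{1,-1\}$. Addition is disjoint union, $-G$ reverses all signs, and products are taken term by term with signs multiplied. The strong ring is the commutative ring of signed complexes modulo isomorphism of summands, splitting of summands into connected components (with the same sign), and cancellation of $G\oplus(-G)$; its zero is the empty complex and its one is the one-point complex $K_1$. For a product complex $G$, the $k$-th Wu characteristic is $$\omega_k(G)=\sum_{(x_1,\dots,x_k)}\omega(x_1)\cdots\omega(x_k),$$ the sum being over all ordered $k$-tuples of cells of $G$ that intersect simultaneously, i.e. $x_1\cap\cdots\cap x_k\neq\emptyset$. Thus $\omega_1=\chi$ is the Euler characteristic and $\omega_2$ is the Wu characteristic. For a signed complex with summands $G_i$ and signs $\varepsilon_i$, $\omega_k(G)=\sum_i\varepsilon_i\omega_k(G_i)$ (so $\omega_k(-G)=-\omega_k(G)$). *)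

theory Defs
  imports "HOL-Library.Multiset" "HOL-Algebra.IntRing"
begin

definition simplicial_complex :: "'a set set \<Rightarrow> bool" where
  "simplicial_complex K \<longleftrightarrow>
     finite K \<and> (\<forall>x\<in>K. finite x \<and> x \<noteq> {}) \<and> (\<forall>x\<in>K. \<forall>y. y \<subseteq> x \<and> y \<noteq> {} \<longrightarrow> y \<in> K)"

(* The list [G1,...,Gn] stands for the product complex G1 x ... x Gn. *)
type_synonym 'a product_complex = "'a set set list"

definition product_complex :: "'a product_complex \<Rightarrow> bool" where
  "product_complex G \<longleftrightarrow> G \<noteq> [] \<and> (\<forall>K\<in>set G. simplicial_complex K)"

(* A cell x = x1 x ... x xn is given by its list of factors [x1,...,xn]; the set x itself is
   listset [x1,...,xn], and inclusion and intersection of cells always refer to these sets.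
   By inj_on_listset_cells below, distinct lists of factors give distinct sets. *)
type_synonym 'a cell = "'a set list"

definition cells :: "'a product_complex \<Rightarrow> 'a cell set" where
  "cells G = listset G"

definition cell_dim :: "'a cell \<Rightarrow> nat" where
  "cell_dim x = (\<Sum>s\<leftarrow>x. card s - 1)"

definition cell_sign :: "'a cell \<Rightarrow> int" where
  "cell_sign x = (- 1) ^ cell_dim x"

definition pc_iso :: "'a product_complex \<Rightarrow> 'b product_complex \<Rightarrow> bool" where
  "pc_iso G H \<longleftrightarrow>
     (\<exists>f. bij_betw f (cells G) (cells H) \<and>
          (\<forall>x\<in>cells G. \<forall>y\<in>cells G. listset x \<subseteq> listset y \<longleftrightarrow> listset (f x) \<subseteq> listset (f y)))"

definition incidence :: "'a product_complex \<Rightarrow> ('a cell \<times> 'a cell) set" where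
  "incidence G = {(x, y). x \<in> cells G \<and> y \<in> cells G \<and>
                          (listset x \<subseteq> listset y \<or> listset y \<subseteq> listset x)}"

(* The connected components, as sets of cells. *)
definition components :: "'a product_complex \<Rightarrow> 'a cell set set" where
  "components G = cells G // (incidence G)\<^sup>+"

(* A signed complex is the multiset of its summands, each paired with its sign. *)
type_synonym 'a signed_complex = "(int \<times> 'a product_complex) multiset"

definition signed_complexes :: "'a signed_complex set" where
  "signed_complexes = {A. \<forall>(s, G)\<in>#A. s \<in> {1, - 1} \<and> product_complex G}"

definition neg_sc :: "'a signed_complex \<Rightarrow> 'a signed_complex" where
  "neg_sc A = image_mset (\<lambda>(s, G). (- s, G)) A"

(* Concatenating the lists of factors gives the Cartesian product of product complexes. *)
definition mult_sc :: "'a signed_complex \<Rightarrow> 'a signed_complex \<Rightarrow> 'a signed_complex" where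
  "mult_sc A B = (\<Sum>(s, G)\<in>#A. image_mset (\<lambda>(t, H). (s * t, G @ H)) B)"

inductive strong_eq :: "'a signed_complex \<Rightarrow> 'a signed_complex \<Rightarrow> bool" where
  refl: "A \<in> signed_complexes \<Longrightarrow> strong_eq A A"
| sym: "strong_eq A B \<Longrightarrow> strong_eq B A"
| trans: "strong_eq A B \<Longrightarrow> strong_eq B C \<Longrightarrow> strong_eq A C"
| add: "strong_eq A B \<Longrightarrow> C \<in> signed_complexes \<Longrightarrow> strong_eq (A + C) (B + C)"
| iso: "s \<in> {1, - 1} \<Longrightarrow> product_complex G \<Longrightarrow> product_complex H \<Longrightarrow> pc_iso G H \<Longrightarrow>
        strong_eq {#(s, G)#} {#(s, H)#}"
| split: "s \<in> {1, - 1} \<Longrightarrow> product_complex G \<Longrightarrow> (\<forall>D\<in>#Ds. product_complex D) \<Longrightarrow>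
          image_mset cells Ds = mset_set (components G) \<Longrightarrow>
          strong_eq {#(s, G)#} (image_mset (Pair s) Ds)"
| cancel: "A \<in> signed_complexes \<Longrightarrow> strong_eq (A + neg_sc A) {#}"

definition strong_rel :: "('a signed_complex \<times> 'a signed_complex) set" where
  "strong_rel = {(A, B). strong_eq A B}"

definition strong_class :: "'a signed_complex \<Rightarrow> 'a signed_complex set" where
  "strong_class A = strong_rel `` {A}"

(* The vertex of the one-point complex is irrelevant up to isomorphism. *)
definition one_point :: "'a product_complex" where
  "one_point = [{{undefined}}]"

definition strong_ring :: "'a signed_complex set ring" where
  "strong_ring =
     \<lparr>carrier = signed_complexes // strong_rel,
      mult = (\<lambda>X Y. \<Union>A\<in>X. \<Union>B\<in>Y. strong_class (mult_sc A B)),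
      one = strong_class {#(1, one_point)#},
      zero = strong_class {#},
      add = (\<lambda>X Y. \<Union>A\<in>X. \<Union>B\<in>Y. strong_class (A + B))\<rparr>"

definition wu_tuples :: "nat \<Rightarrow> 'a product_complex \<Rightarrow> 'a cell list set" where
  "wu_tuples k G =
     {xs. length xs = k \<and> set xs \<subseteq> cells G \<and> (\<Inter>x\<in>set xs. listset x) \<noteq> {}}"

definition wu_pc :: "nat \<Rightarrow> 'a product_complex \<Rightarrow> int" where
  "wu_pc k G = (\<Sum>xs\<in>wu_tuples k G. \<Prod>x\<leftarrow>xs. cell_sign x)"

definition wu :: "nat \<Rightarrow> 'a signed_complex \<Rightarrow> int" where
  "wu k A = (\<Sum>(s, G)\<in>#A. s * wu_pc k G)"

(* The value of wu k on a class, meaningful as soon as wu k is constant on it. *)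
definition wu_class :: "nat \<Rightarrow> 'a signed_complex set \<Rightarrow> int" where
  "wu_class k X = the_elem (wu k ` X)"

lemma mem_listset_iff: "v \<in> listset x \<longleftrightarrow> list_all2 (\<in>) v x"
  by (induction x arbitrary: v) (auto simp: set_Cons_def list_all2_Cons2)

lemma listset_nonempty: "\<forall>s\<in>set x. s \<noteq> {} \<Longrightarrow> listset x \<noteq> {}"
  by (induction x) (auto simp: set_Cons_def)

lemma cells_nonempty_factors:
  assumes "product_complex G" "x \<in> cells G"
  shows "\<forall>s\<in>set x. s \<noteq> {}"
proof -
  have "\<forall>i<length G. x ! i \<in> G ! i" "length x = length G"
    using assms(2) by (auto simp: cells_def mem_listset_iff list_all2_conv_all_nth)
  moreover have "\<forall>i<length G. simplicial_complex (G ! i)"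
    using assms(1) by (simp add: product_complex_def)
  ultimately show ?thesis
    by (metis in_set_conv_nth simplicial_complex_def)
qed

lemma listset_inj:
  assumes "listset x = listset y" "\<forall>s\<in>set x. s \<noteq> {}" "\<forall>s\<in>set y. s \<noteq> {}"
  shows "x = y"
  using assms
proof (induction x arbitrary: y)
  case Nil
  then show ?case by (cases y) (auto simp: set_Cons_def)
next
  case (Cons a x)
  obtain v where v: "v \<in> listset x" using listset_nonempty Cons.prems(2) by fastforce
  obtain p where p: "p \<in> a" using Cons.prems(2) by auto
  have "p # v \<in> listset y" using v p Cons.prems(1) by (auto simp: set_Cons_def)
  then obtain b z where y: "y = b # z" and "p \<in> b" "v \<in> listset z"
    by (cases y) (auto simp: set_Cons_def)
  have eq: "u \<in> a \<and> w \<in> listset x \<longleftrightarrow> u \<in> b \<and> w \<in> listset z" for u w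
    using Cons.prems(1) unfolding y by (auto simp: set_Cons_def set_eq_iff)
  have "a = b" using eq v \<open>v \<in> listset z\<close> by blast
  moreover have "listset x = listset z" using eq p \<open>p \<in> b\<close> by blast
  ultimately show ?case using Cons.IH Cons.prems y by auto
qed

lemma inj_on_listset_cells: "product_complex G \<Longrightarrow> inj_on listset (cells G)"
  by (rule inj_onI) (rule listset_inj, auto dest: cells_nonempty_factors)

lemma empty_complex_strong_eq_zero: "strong_eq {#(1, [{}])#} {#}"
proof -
  have "strong_eq {#(1, [{}])#} (image_mset (Pair 1) {#})"
    by (rule strong_eq.split)
      (auto simp: product_complex_def simplicial_complex_def components_def cells_def
        quotient_def)
  then show ?thesis by simp
qed

end

theory Submission
  imports Defs
begin

text \<open>
  Three facts carry the proof.

  First, the Wu characteristic of a product complex depends only on its poset of cells. Cells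
  meet iff they have a common face, and the sign of a cell is determined by the poset, because
  the faces of a cell form a product of full simplices, whose Euler characteristic is \<open>1\<close>; hence
  \<open>\<omega>(x) = 1 - (\<Sum>y<x. \<omega>(y))\<close>, and signs are recovered by induction from below
  (\<open>cell_sign_recursion\<close>, \<open>cell_sign_iso\<close>). This gives invariance under isomorphism. Cells that
  meet are all comparable to a common face, hence lie in one connected component; this gives
  additivity over components. Invariance under cancellation is immediate from the signs.

  Secondly, \<open>\<omega>\<^sub>k\<close> is multiplicative: a \<open>k\<close>-tuple of cells of \<open>G \<times> H\<close> is a pair of \<open>k\<close>-tuples of
  cells of \<open>G\<close> and \<open>H\<close>, it meets iff both tuples do, and signs multiply (\<open>wu_pc_append\<close>).

  Thirdly, the strong ring is a ring. The delicate point is that products respect strong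
  equality, and there the delicate rule is splitting into components. If \<open>G\<close> splits into
  components \<open>D\<close>, then \<open>G \<times> L\<close> must be shown equal to the sum of the \<open>D \<times> L\<close>; but this is not
  itself a splitting into components when \<open>L\<close> is disconnected. The components of \<open>G \<times> L\<close> are the products of
  components of \<open>G\<close> and \<open>L\<close> (\<open>components_append\<close>), and every component of a product complex is
  again a product complex (\<open>component_is_product_complex\<close>). So \<open>G \<times> L\<close> and the sum of the \<open>D \<times> L\<close>
  have a common refinement into components (\<open>splitting_append\<close>).
\<close>

section \<open>Cells of products\<close>

lemma mem_cells_iff: "x \<in> cells G \<longleftrightarrow> list_all2 (\<in>) x G"
  by (simp add: cells_def mem_listset_iff)

lemma length_cell: "x \<in> cells G \<Longrightarrow> length x = length G"
  by (simp add: mem_cells_iff list_all2_lengthD)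

lemma product_complex_append:
  "product_complex G \<Longrightarrow> product_complex H \<Longrightarrow> product_complex (G @ H)"
  by (auto simp: product_complex_def)

lemma finite_cells:
  assumes "product_complex G"
  shows "finite (cells G)"
proof -
  have "finite (listset Ks)" if "\<forall>K\<in>set Ks. finite K" for Ks :: "'b set list"
    using that by (induction Ks) (auto simp: set_Cons_def finite_image_set2)
  then show ?thesis
    using assms by (auto simp: cells_def product_complex_def simplicial_complex_def)
qed

text \<open>
  Inclusion of boxes is factorwise as soon as the smaller box is non-empty: a point of it
  fixes the other coordinates while one coordinate varies.
\<close>

lemma listset_subset_iff:
  assumes "\<forall>s\<in>set x. s \<noteq> {}"
  shows "listset x \<subseteq> listset y \<longleftrightarrow> list_all2 (\<subseteq>) x y"
proof
  show "listset x \<subseteq> listset y \<Longrightarrow> list_all2 (\<subseteq>) x y"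
    using assms
  proof (induction x arbitrary: y)
    case Nil
    then show ?case by (cases y) (auto simp: set_Cons_def)
  next
    case (Cons a x)
    obtain v where v: "v \<in> listset x" using listset_nonempty Cons.prems(2) by fastforce
    obtain p where p: "p \<in> a" using Cons.prems(2) by auto
    have "p # v \<in> listset y" using v p Cons.prems(1) by (auto simp: set_Cons_def)
    then obtain b z where y: "y = b # z" by (cases y) (auto simp: set_Cons_def)
    have "u \<in> b \<and> w \<in> listset z" if "u \<in> a" "w \<in> listset x" for u w
      using Cons.prems(1) that unfolding y by (auto simp: set_Cons_def)
    then have "a \<subseteq> b" "listset x \<subseteq> listset z" using v p by blast+
    then show ?case using Cons y by simp
  qed
  show "list_all2 (\<subseteq>) x y \<Longrightarrow> listset x \<subseteq> listset y"
    by (fastforce simp: mem_listset_iff list_all2_conv_all_nth)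
qed

lemma cell_subset_iff:
  assumes "product_complex G" "x \<in> cells G"
  shows "listset x \<subseteq> listset y \<longleftrightarrow> list_all2 (\<subseteq>) x y"
  using assms by (intro listset_subset_iff cells_nonempty_factors)

definition cell_prod :: "'a cell set \<Rightarrow> 'a cell set \<Rightarrow> 'a cell set" where
  "cell_prod C D = (\<lambda>(x, y). x @ y) ` (C \<times> D)"

lemma cells_append: "cells (G @ H) = cell_prod (cells G) (cells H)"
proof (intro equalityI subsetI)
  fix z assume "z \<in> cells (G @ H)"
  then obtain x y where "z = x @ y" "x \<in> cells G" "y \<in> cells H"
    by (auto simp: mem_cells_iff list_all2_append2)
  then show "z \<in> cell_prod (cells G) (cells H)" by (auto simp: cell_prod_def)
qed (auto simp: cell_prod_def mem_cells_iff intro: list_all2_appendI)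

text \<open>
  All cells of a given complex have the same number of factors, so a cell of a product can be
  cut into its two parts in only one way.
\<close>

lemma inj_on_append_cells: "inj_on (\<lambda>(x, y). x @ y) (cells G \<times> cells H)"
  by (auto simp: inj_on_def append_eq_append_conv length_cell)

lemma bij_betw_append_cells:
  "bij_betw (\<lambda>(x, y). x @ y) (cells G \<times> cells H) (cells (G @ H))"
  unfolding cells_append cell_prod_def by (rule inj_on_imp_bij_betw[OF inj_on_append_cells])

lemma append_cell_subset_iff:
  assumes "product_complex G" "product_complex H"
    and "x \<in> cells G" "x' \<in> cells G" "y \<in> cells H"
  shows "listset (x @ y) \<subseteq> listset (x' @ y') \<longleftrightarrow>
    listset x \<subseteq> listset x' \<and> listset y \<subseteq> listset y'"
proof -
  have "x @ y \<in> cells (G @ H)"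
    using assms by (auto simp: cells_append cell_prod_def)
  then show ?thesis
    using assms by (simp add: cell_subset_iff[OF product_complex_append] cell_subset_iff
        list_all2_append length_cell)
qed

lemma cell_sign_append: "cell_sign (x @ y) = cell_sign x * cell_sign y"
  by (simp add: cell_sign_def cell_dim_def power_add)

section \<open>Signs are determined by the inclusion order\<close>

text \<open>
  The closed cell of \<open>x\<close> is itself a product complex, the product of the full simplices on the
  factors of \<open>x\<close>; writing it as such makes sums over faces factor.
\<close>

definition faces :: "'a cell \<Rightarrow> 'a cell set" where
  "faces x = listset (map (\<lambda>s. Pow s - {{}}) x)"

lemma mem_faces_iff:
  "y \<in> faces x \<longleftrightarrow> list_all2 (\<subseteq>) y x \<and> (\<forall>s\<in>set y. s \<noteq> {})"
proof -
  have "y \<in> faces x \<longleftrightarrow> list_all2 (\<lambda>s t. s \<subseteq> t \<and> s \<noteq> {}) y x"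
    by (simp add: faces_def mem_listset_iff list_all2_map2)
  also have "\<dots> \<longleftrightarrow> list_all2 (\<subseteq>) y x \<and> (\<forall>s\<in>set y. s \<noteq> {})"
    unfolding list_all2_conv_all_nth all_set_conv_all_nth by metis
  finally show ?thesis .
qed

lemma faces_eq_cells_below:
  assumes G: "product_complex G" and x: "x \<in> cells G"
  shows "faces x = {y \<in> cells G. listset y \<subseteq> listset x}"
proof (intro equalityI subsetI)
  fix y assume "y \<in> faces x"
  then have y: "list_all2 (\<subseteq>) y x" "\<forall>s\<in>set y. s \<noteq> {}" by (auto simp: mem_faces_iff)
  have len: "length y = length G" "length x = length G"
    using y x by (auto simp: list_all2_lengthD length_cell)
  have "y ! i \<in> G ! i" if "i < length G" for i
  proof -
    have "simplicial_complex (G ! i)" using G that by (simp add: product_complex_def)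
    moreover have "x ! i \<in> G ! i" "y ! i \<subseteq> x ! i" "y ! i \<noteq> {}"
      using that x y len by (auto simp: mem_cells_iff list_all2_conv_all_nth)
    ultimately show ?thesis unfolding simplicial_complex_def by blast
  qed
  then have "y \<in> cells G" using len by (simp add: mem_cells_iff list_all2_conv_all_nth)
  then show "y \<in> {y \<in> cells G. listset y \<subseteq> listset x}"
    using y by (simp add: listset_subset_iff)
next
  fix y assume "y \<in> {y \<in> cells G. listset y \<subseteq> listset x}"
  then show "y \<in> faces x"
    using G cells_nonempty_factors[OF G] by (auto simp: mem_faces_iff cell_subset_iff)
qed

text \<open>
  Expand the vanishing product \<open>\<Prod>a\<in>t. (1 - 1)\<close>.
\<close>

lemma sum_sign_Pow:
  assumes "finite t" "t \<noteq> {}"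
  shows "(\<Sum>s\<in>Pow t. (- 1 :: int) ^ card s) = 0"
  using prod_diff_conv_sum[OF assms(1), of "\<lambda>_. 1 :: int" "\<lambda>_. 1"] assms
  by (simp add: power_0_left card_gt_0_iff)

lemma sum_sign_simplex_faces:
  assumes "finite t" "t \<noteq> {}"
  shows "(\<Sum>s\<in>Pow t - {{}}. (- 1 :: int) ^ (card s - 1)) = 1"
proof -
  have "(\<Sum>s\<in>Pow t - {{}}. (- 1 :: int) ^ (card s - 1)) = (\<Sum>s\<in>Pow t - {{}}. - ((- 1) ^ card s))"
  proof (rule sum.cong[OF HOL.refl])
    fix s assume "s \<in> Pow t - {{}}"
    then have "card s > 0" using assms(1) by (auto simp: card_gt_0_iff intro: finite_subset)
    then show "(- 1 :: int) ^ (card s - 1) = - ((- 1) ^ card s)" by (cases "card s") auto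
  qed
  also have "\<dots> = (- 1) ^ card ({} :: 'a set) - (\<Sum>s\<in>Pow t. (- 1) ^ card s)"
    using assms(1) by (simp add: sum_negf sum_diff1)
  finally show ?thesis using sum_sign_Pow[OF assms] by simp
qed

text \<open>
  The Euler characteristic is multiplicative, and it is \<open>1\<close> for a full simplex.
\<close>

lemma sum_sign_faces:
  assumes "\<forall>s\<in>set x. finite s \<and> s \<noteq> {}"
  shows "(\<Sum>y\<in>faces x. cell_sign y) = 1"
  using assms
proof (induction x)
  case Nil
  then show ?case by (simp add: faces_def cell_sign_def cell_dim_def)
next
  case (Cons t x)
  have inj: "inj_on (\<lambda>p. fst p # snd p) ((Pow t - {{}}) \<times> faces x)" by (auto simp: inj_on_def)
  have sgn: "cell_sign (s # y) = (- 1) ^ (card s - 1) * cell_sign y" for s and y :: "'a cell"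
    by (simp add: cell_sign_def cell_dim_def power_add)
  have img: "faces (t # x) = (\<lambda>p. fst p # snd p) ` ((Pow t - {{}}) \<times> faces x)"
    unfolding faces_def list.map listset.simps set_Cons_def image_def by (auto simp: Bex_def)
  have "(\<Sum>y\<in>faces (t # x). cell_sign y) =
      (\<Sum>(s, y)\<in>(Pow t - {{}}) \<times> faces x. (- 1) ^ (card s - 1) * cell_sign y)"
    unfolding img sum.reindex[OF inj] by (rule sum.cong[OF HOL.refl]) (simp add: sgn case_prod_unfold)
  also have "\<dots> = (\<Sum>s\<in>Pow t - {{}}. (- 1) ^ (card s - 1)) * (\<Sum>y\<in>faces x. cell_sign y)"
    by (simp add: sum_product sum.cartesian_product)
  also have "\<dots> = 1"
    using Cons sum_sign_simplex_faces[of t] by simp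
  finally show ?case .
qed

text \<open>
  This isolates the top cell in the previous sum. The right-hand side mentions the complex only
  through its inclusion order and the signs of smaller cells, so the sign of a cell can be
  recovered from the order alone.
\<close>

lemma cell_sign_recursion:
  assumes G: "product_complex G" and x: "x \<in> cells G"
  shows "cell_sign x = 1 - (\<Sum>y | y \<in> cells G \<and> listset y \<subset> listset x. cell_sign y)"
proof -
  have "\<forall>s\<in>set x. finite s \<and> s \<noteq> {}"
    using G x by (fastforce simp: product_complex_def simplicial_complex_def mem_cells_iff
        list_all2_conv_all_nth in_set_conv_nth)
  then have "1 = (\<Sum>y | y \<in> cells G \<and> listset y \<subseteq> listset x. cell_sign y)"
    using sum_sign_faces faces_eq_cells_below[OF G x] by metis
  also have "{y. y \<in> cells G \<and> listset y \<subseteq> listset x} =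
      insert x {y. y \<in> cells G \<and> listset y \<subset> listset x}"
    using x inj_on_listset_cells[OF G] by (auto simp: inj_on_def)
  also have "(\<Sum>y\<in>\<dots>. cell_sign y) =
      cell_sign x + (\<Sum>y | y \<in> cells G \<and> listset y \<subset> listset x. cell_sign y)"
    using finite_cells[OF G] by (intro sum.insert) auto
  finally show ?thesis by simp
qed

lemma cell_sign_iso:
  assumes G: "product_complex G" and H: "product_complex H"
    and f: "bij_betw f (cells G) (cells H)"
    and incl: "\<And>x y. x \<in> cells G \<Longrightarrow> y \<in> cells G \<Longrightarrow>
      listset x \<subseteq> listset y \<longleftrightarrow> listset (f x) \<subseteq> listset (f y)"
    and x: "x \<in> cells G"
  shows "cell_sign (f x) = cell_sign x"
  using x
proof (induction "card {y \<in> cells G. listset y \<subset> listset x}" arbitrary: x rule: less_induct)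
  case less
  let ?below = "\<lambda>G x. {y. y \<in> cells G \<and> listset y \<subset> listset x}"
  have maps: "f y \<in> cells H" if "y \<in> cells G" for y using f that by (auto simp: bij_betw_def)
  have "f ` ?below G x = ?below H (f x)"
  proof (intro equalityI subsetI)
    fix z assume "z \<in> f ` ?below G x"
    then show "z \<in> ?below H (f x)" using incl less.prems maps by (auto simp: less_le_not_le)
  next
    fix z assume z: "z \<in> ?below H (f x)"
    then obtain y where "y \<in> cells G" "z = f y" using f by (auto simp: bij_betw_def)
    then show "z \<in> f ` ?below G x" using incl less.prems z by (auto simp: less_le_not_le)
  qed
  then have bij: "bij_betw f (?below G x) (?below H (f x))"
    using f by (auto simp: bij_betw_def inj_on_def)
  have "cell_sign (f y) = cell_sign y" if "y \<in> ?below G x" for y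
  proof (rule less.hyps)
    have "?below G y \<subset> ?below G x" using that by auto
    then show "card (?below G y) < card (?below G x)"
      using finite_cells[OF G] by (intro psubset_card_mono) auto
    show "y \<in> cells G" using that by simp
  qed
  then have "(\<Sum>z\<in>?below H (f x). cell_sign z) = (\<Sum>y\<in>?below G x. cell_sign y)"
    using sum.reindex_bij_betw[OF bij, of cell_sign] by (metis (no_types, lifting) sum.cong)
  then show ?case
    using cell_sign_recursion[OF G less.prems] cell_sign_recursion[OF H maps[OF less.prems]] by simp
qed

section \<open>Wu characteristics of isomorphic complexes and of products\<close>

text \<open>
  A common point \<open>v\<close> yields the vertex \<open>{v}\<close>, which is a face of every cell containing \<open>v\<close>.
  The right-hand side refers only to the inclusion order, and so is invariant under isomorphism;
  it also exhibits one cell to which all cells of the tuple are incident. The empty tuple is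
  excluded because its intersection is everything even when \<open>G\<close> has no cells.
\<close>

lemma meet_iff_common_face:
  assumes G: "product_complex G" and xs: "set xs \<subseteq> cells G" "xs \<noteq> []"
  shows "(\<Inter>x\<in>set xs. listset x) \<noteq> {} \<longleftrightarrow> (\<exists>y\<in>cells G. \<forall>x\<in>set xs. listset y \<subseteq> listset x)"
proof
  assume "(\<Inter>x\<in>set xs. listset x) \<noteq> {}"
  then obtain v where v: "\<And>x. x \<in> set xs \<Longrightarrow> v \<in> listset x" by blast
  let ?y = "map (\<lambda>p. {p}) v"
  have below: "list_all2 (\<subseteq>) ?y x" if "x \<in> set xs" for x
    using v[OF that] by (simp add: mem_listset_iff list_all2_conv_all_nth)
  obtain x where x: "x \<in> set xs" using xs(2) by (cases xs) auto
  then have "?y \<in> faces x" using below by (auto simp: mem_faces_iff)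
  then have "?y \<in> cells G" using faces_eq_cells_below[OF G] x xs(1) by blast
  moreover have "listset ?y \<subseteq> listset x" if "x \<in> set xs" for x
    using below[OF that] by (subst listset_subset_iff) auto
  ultimately show "\<exists>y\<in>cells G. \<forall>x\<in>set xs. listset y \<subseteq> listset x" by blast
next
  assume "\<exists>y\<in>cells G. \<forall>x\<in>set xs. listset y \<subseteq> listset x"
  then obtain y where y: "y \<in> cells G" "\<forall>x\<in>set xs. listset y \<subseteq> listset x" by blast
  then have "listset y \<noteq> {}" using listset_nonempty cells_nonempty_factors[OF G] by blast
  then show "(\<Inter>x\<in>set xs. listset x) \<noteq> {}" using y(2) by blast
qed

lemma wu_pc_iso:
  assumes G: "product_complex G" and H: "product_complex H" and "pc_iso G H" and k: "k \<ge> 1"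
  shows "wu_pc k G = wu_pc k H"
proof -
  obtain f where f: "bij_betw f (cells G) (cells H)"
    and incl: "\<And>x y. x \<in> cells G \<Longrightarrow> y \<in> cells G \<Longrightarrow>
      listset x \<subseteq> listset y \<longleftrightarrow> listset (f x) \<subseteq> listset (f y)"
    using assms(3) unfolding pc_iso_def by blast
  have img: "f ` cells G = cells H" and inj: "inj_on f (cells G)"
    using f by (auto simp: bij_betw_def)
  have meet: "map f xs \<in> wu_tuples k H \<longleftrightarrow> xs \<in> wu_tuples k G"
    if xs: "set xs \<subseteq> cells G" for xs
  proof (cases "length xs = k")
    case True
    then have ne: "xs \<noteq> []" using k by auto
    have "set (map f xs) \<subseteq> cells H" using xs img by auto
    then have "(\<Inter>x\<in>set (map f xs). listset x) \<noteq> {} \<longleftrightarrow>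
        (\<exists>z\<in>cells H. \<forall>x\<in>set (map f xs). listset z \<subseteq> listset x)"
      using ne by (intro meet_iff_common_face[OF H]) auto
    also have "\<dots> \<longleftrightarrow> (\<exists>y\<in>cells G. \<forall>x\<in>set xs. listset (f y) \<subseteq> listset (f x))"
      unfolding img[symmetric] by simp
    also have "\<dots> \<longleftrightarrow> (\<exists>y\<in>cells G. \<forall>x\<in>set xs. listset y \<subseteq> listset x)"
      using incl xs by (meson subsetD)
    also have "\<dots> \<longleftrightarrow> (\<Inter>x\<in>set xs. listset x) \<noteq> {}"
      using meet_iff_common_face[OF G xs ne] by simp
    finally show ?thesis using xs img True by (auto simp: wu_tuples_def)
  qed (auto simp: wu_tuples_def)
  have sub: "set xs \<subseteq> cells G" if "xs \<in> wu_tuples k G" for xs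
    using that by (simp add: wu_tuples_def)
  have "inj_on (map f) (wu_tuples k G)"
    using map_inj_on[of f] sub by (meson Un_least inj inj_onI inj_on_subset)
  moreover have "map f ` wu_tuples k G = wu_tuples k H"
  proof (intro equalityI subsetI)
    fix ys assume ys: "ys \<in> wu_tuples k H"
    then have "ys \<in> lists (f ` cells G)" by (auto simp: wu_tuples_def img)
    then obtain xs where "set xs \<subseteq> cells G" "ys = map f xs"
      by (auto simp: lists_image)
    then show "ys \<in> map f ` wu_tuples k G" using ys meet by blast
  qed (use meet sub in blast)
  ultimately have bij: "bij_betw (map f) (wu_tuples k G) (wu_tuples k H)"
    by (simp add: bij_betw_def)
  have sgn: "map cell_sign (map f xs) = map cell_sign xs" if "xs \<in> wu_tuples k G" for xs
    using sub[OF that] cell_sign_iso[OF G H f incl] by auto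
  show ?thesis
    unfolding wu_pc_def sum.reindex_bij_betw[OF bij, symmetric]
    by (rule sum.cong[OF HOL.refl]) (simp only: sgn)
qed

lemma mem_listset_append_iff:
  "v \<in> listset (x @ y) \<longleftrightarrow>
    take (length x) v \<in> listset x \<and> drop (length x) v \<in> listset y"
proof
  assume "v \<in> listset (x @ y)"
  then obtain u w where "v = u @ w" "u \<in> listset x" "w \<in> listset y"
    by (auto simp: mem_listset_iff list_all2_append2)
  moreover from this have "length u = length x"
    by (auto simp: mem_listset_iff list_all2_lengthD)
  ultimately show "take (length x) v \<in> listset x \<and> drop (length x) v \<in> listset y" by simp
next
  assume "take (length x) v \<in> listset x \<and> drop (length x) v \<in> listset y"
  then have "list_all2 (\<in>) (take (length x) v @ drop (length x) v) (x @ y)"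
    unfolding mem_listset_iff by (intro list_all2_appendI) auto
  then show "v \<in> listset (x @ y)" by (simp add: mem_listset_iff)
qed

text \<open>
  Concatenating two tuples entrywise is a bijection from pairs of meeting tuples to meeting
  tuples of the product: an intersection of products is the product of the intersections.
\<close>

lemma wu_pc_append: "wu_pc k (G @ H) = wu_pc k G * wu_pc k H"
proof -
  let ?zip = "\<lambda>(xs, ys). map2 (@) xs ys"
  have inj: "inj_on ?zip (wu_tuples k G \<times> wu_tuples k H)"
  proof (rule inj_onI, clarify)
    fix xs ys xs' ys' :: "'a cell list"
    assume *: "xs \<in> wu_tuples k G" "ys \<in> wu_tuples k H" "xs' \<in> wu_tuples k G"
      "ys' \<in> wu_tuples k H" and eq: "map2 (@) xs ys = map2 (@) xs' ys'"
    have len: "length xs = k" "length ys = k" "length xs' = k" "length ys' = k"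
      using * by (auto simp: wu_tuples_def)
    have "xs ! i = xs' ! i \<and> ys ! i = ys' ! i" if "i < k" for i
    proof -
      have "length (xs ! i) = length G" "length (xs' ! i) = length G"
        using * that len by (auto simp: wu_tuples_def subset_iff intro!: length_cell)
      moreover have "xs ! i @ ys ! i = xs' ! i @ ys' ! i"
        using arg_cong[OF eq, of "\<lambda>l. l ! i"] that len by simp
      ultimately show ?thesis by simp
    qed
    then show "xs = xs' \<and> ys = ys'" using len by (auto intro: nth_equalityI)
  qed
  have meet: "(\<Inter>z\<in>set (map2 (@) xs ys). listset z) \<noteq> {} \<longleftrightarrow>
      (\<Inter>x\<in>set xs. listset x) \<noteq> {} \<and> (\<Inter>y\<in>set ys. listset y) \<noteq> {}"
    if len: "length xs = k" "length ys = k" and "set xs \<subseteq> cells G" "set ys \<subseteq> cells H" for xs ys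
  proof -
    have x: "xs ! i \<in> cells G" if "i < k" for i
      using that \<open>length xs = k\<close> \<open>set xs \<subseteq> cells G\<close> by auto
    have inter: "(\<Inter>z\<in>set zs. listset z) = {v. \<forall>i<k. v \<in> listset (zs ! i)}"
      if "length zs = k" for zs :: "'a cell list"
    proof -
      have "(\<Inter>z\<in>set zs. listset z) = {v. \<forall>z\<in>set zs. v \<in> listset z}" by blast
      then show ?thesis using that by (simp add: all_set_conv_all_nth)
    qed
    have split: "v \<in> listset (xs ! i @ ys ! i) \<longleftrightarrow>
        take (length G) v \<in> listset (xs ! i) \<and> drop (length G) v \<in> listset (ys ! i)"
      if "i < k" for i v
      using mem_listset_append_iff[of v "xs ! i" "ys ! i"] x[OF that] by (simp add: length_cell)
    have join: "v @ w \<in> listset (xs ! i @ ys ! i)"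
      if "v \<in> listset (xs ! i)" "w \<in> listset (ys ! i)" for i v w
      using that by (simp add: mem_listset_iff list_all2_appendI)
    have "(\<Inter>z\<in>set (map2 (@) xs ys). listset z) = {v. \<forall>i<k. v \<in> listset (map2 (@) xs ys ! i)}"
      by (rule inter) (simp add: len)
    also have "\<dots> = {v. \<forall>i<k. v \<in> listset (xs ! i @ ys ! i)}"
      using len by auto
    also have "\<dots> \<noteq> {} \<longleftrightarrow> {v. \<forall>i<k. v \<in> listset (xs ! i)} \<noteq> {} \<and>
        {w. \<forall>i<k. w \<in> listset (ys ! i)} \<noteq> {}"
      using split join by blast
    finally show ?thesis
      unfolding inter[OF len(1)] inter[OF len(2)] .
  qed
  have img: "?zip ` (wu_tuples k G \<times> wu_tuples k H) = wu_tuples k (G @ H)"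
  proof (intro equalityI subsetI)
    fix zs assume "zs \<in> ?zip ` (wu_tuples k G \<times> wu_tuples k H)"
    then obtain xs ys where "zs = map2 (@) xs ys" and
      *: "length xs = k" "length ys = k" "set xs \<subseteq> cells G" "set ys \<subseteq> cells H"
      "(\<Inter>x\<in>set xs. listset x) \<noteq> {}" "(\<Inter>y\<in>set ys. listset y) \<noteq> {}"
      by (auto simp: wu_tuples_def)
    moreover have "set (map2 (@) xs ys) \<subseteq> cells (G @ H)"
      using * by (auto simp: cells_append cell_prod_def dest: set_zip_leftD set_zip_rightD)
    ultimately show "zs \<in> wu_tuples k (G @ H)"
      using meet[OF *(1-4)] by (simp add: wu_tuples_def)
  next
    fix zs assume "zs \<in> wu_tuples k (G @ H)"
    then have zs: "length zs = k" "set zs \<subseteq> cells (G @ H)" "(\<Inter>z\<in>set zs. listset z) \<noteq> {}"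
      by (auto simp: wu_tuples_def)
    let ?xs = "map (take (length G)) zs" and ?ys = "map (drop (length G)) zs"
    have zip: "zs = map2 (@) ?xs ?ys"
      by (simp add: zip_map_map zip_same_conv_map comp_def)
    have xy: "set ?xs \<subseteq> cells G" "set ?ys \<subseteq> cells H"
      using zs(2) by (auto simp: cells_append cell_prod_def length_cell subset_iff)
    have "(?xs, ?ys) \<in> wu_tuples k G \<times> wu_tuples k H"
      using meet[OF _ _ xy] zs zip xy by (simp add: wu_tuples_def)
    then show "zs \<in> ?zip ` (wu_tuples k G \<times> wu_tuples k H)"
      using zip by (metis (no_types, lifting) case_prod_conv image_eqI)
  qed
  have sgn: "(\<Prod>z\<leftarrow>map2 (@) xs ys. cell_sign z) =
      (\<Prod>x\<leftarrow>xs. cell_sign x) * (\<Prod>y\<leftarrow>ys. cell_sign y)"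
    if "length xs = length ys" for xs ys :: "'a cell list"
    using that by (induction xs ys rule: list_induct2) (auto simp: cell_sign_append)
  have "wu_pc k (G @ H) = (\<Sum>(xs, ys)\<in>wu_tuples k G \<times> wu_tuples k H.
      (\<Prod>x\<leftarrow>xs. cell_sign x) * (\<Prod>y\<leftarrow>ys. cell_sign y))"
    unfolding wu_pc_def img[symmetric] sum.reindex[OF inj]
    by (rule sum.cong[OF HOL.refl]) (clarsimp simp: sgn wu_tuples_def simp del: map_map)
  also have "\<dots> = wu_pc k G * wu_pc k H"
    by (simp add: wu_pc_def sum_product sum.cartesian_product)
  finally show ?thesis .
qed

section \<open>Connected components\<close>

lemma equiv_connected:
  "equiv (cells G) ((incidence G)\<^sup>+)"
proof (rule equivI)
  show "(incidence G)\<^sup>+ \<subseteq> cells G \<times> cells G"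
    by (rule trancl_subset_Sigma) (auto simp: incidence_def)
  show "refl_on (cells G) ((incidence G)\<^sup>+)"
    by (rule refl_onI) (auto simp: incidence_def)
  show "sym ((incidence G)\<^sup>+)"
    by (rule sym_trancl) (auto simp: incidence_def sym_def)
qed simp

lemma connected_in_cells: "(x, y) \<in> (incidence G)\<^sup>+ \<Longrightarrow> x \<in> cells G \<and> y \<in> cells G"
  using equiv_type[OF equiv_connected, of G] by blast

lemma components_eq_image: "components G = (\<lambda>x. (incidence G)\<^sup>+ `` {x}) ` cells G"
  by (auto simp: components_def quotient_def)

lemma component_subset: "C \<in> components G \<Longrightarrow> C \<subseteq> cells G"
  unfolding components_def by (rule in_quotient_imp_subset[OF equiv_connected])

lemma component_nonempty: "C \<in> components G \<Longrightarrow> C \<noteq> {}"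
  unfolding components_def by (rule in_quotient_imp_non_empty[OF equiv_connected])

lemma components_disjoint:
  "C \<in> components G \<Longrightarrow> D \<in> components G \<Longrightarrow> C \<noteq> D \<Longrightarrow> C \<inter> D = {}"
  unfolding components_def using quotient_disj[OF equiv_connected] by metis

lemma incidence_append_iff:
  assumes "product_complex G" "product_complex L"
    and "x \<in> cells G" "x' \<in> cells G" "y \<in> cells L" "y' \<in> cells L"
  shows "(x @ y, x' @ y') \<in> incidence (G @ L) \<longleftrightarrow>
    listset x \<subseteq> listset x' \<and> listset y \<subseteq> listset y' \<or>
    listset x' \<subseteq> listset x \<and> listset y' \<subseteq> listset y"
  using assms by (auto simp: incidence_def append_cell_subset_iff cells_append cell_prod_def)

text \<open>
  A path in the product projects to a path in each factor. Conversely, two paths are combined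
  by moving first in one factor and then in the other; moving both at once may not be an
  incidence, as the two inclusions may go in opposite directions.
\<close>

lemma connected_append_iff:
  assumes G: "product_complex G" and L: "product_complex L"
    and x: "x \<in> cells G" and x': "x' \<in> cells G" and y: "y \<in> cells L" and y': "y' \<in> cells L"
  shows "(x @ y, x' @ y') \<in> (incidence (G @ L))\<^sup>+ \<longleftrightarrow>
    (x, x') \<in> (incidence G)\<^sup>+ \<and> (y, y') \<in> (incidence L)\<^sup>+"
proof
  have "(x, u) \<in> (incidence G)\<^sup>+ \<and> (y, v) \<in> (incidence L)\<^sup>+"
    if "(x @ y, z) \<in> (incidence (G @ L))\<^sup>+" "z = u @ v" "u \<in> cells G" "v \<in> cells L" for z u v
    using that
  proof (induction arbitrary: u v rule: trancl_induct)
    case (base z)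
    then show ?case
      using incidence_append_iff[OF G L x _ y] x y by (auto simp: incidence_def)
  next
    case (step w z)
    then obtain s t where w: "w = s @ t" "s \<in> cells G" "t \<in> cells L"
      by (auto simp: incidence_def cells_append cell_prod_def)
    then have "(s, u) \<in> incidence G \<and> (t, v) \<in> incidence L"
      using step incidence_append_iff[OF G L, of s u t v] by (auto simp: incidence_def)
    then show ?case using step.IH[OF w] by (meson trancl.trancl_into_trancl)
  qed
  then show "(x @ y, x' @ y') \<in> (incidence (G @ L))\<^sup>+ \<Longrightarrow>
    (x, x') \<in> (incidence G)\<^sup>+ \<and> (y, y') \<in> (incidence L)\<^sup>+" using x' y' by blast
next
  have left: "(x @ y, u @ y) \<in> (incidence (G @ L))\<^sup>+" if "(x, u) \<in> (incidence G)\<^sup>+" for u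
    using that
  proof (induction rule: trancl_induct)
    case (base u)
    then show ?case using incidence_append_iff[OF G L x _ y y] by (auto simp: incidence_def)
  next
    case (step u w)
    then have "(u @ y, w @ y) \<in> incidence (G @ L)"
      using incidence_append_iff[OF G L _ _ y y] by (auto simp: incidence_def)
    then show ?case using step.IH by (rule trancl_into_trancl[rotated])
  qed
  have right: "(x' @ y, x' @ v) \<in> (incidence (G @ L))\<^sup>+" if "(y, v) \<in> (incidence L)\<^sup>+" for v
    using that
  proof (induction rule: trancl_induct)
    case (base v)
    then show ?case using incidence_append_iff[OF G L x' x' y] by (auto simp: incidence_def)
  next
    case (step v w)
    then have "(x' @ v, x' @ w) \<in> incidence (G @ L)"
      using incidence_append_iff[OF G L x' x'] by (auto simp: incidence_def)
    then show ?case using step.IH by (rule trancl_into_trancl[rotated])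
  qed
  assume "(x, x') \<in> (incidence G)\<^sup>+ \<and> (y, y') \<in> (incidence L)\<^sup>+"
  then show "(x @ y, x' @ y') \<in> (incidence (G @ L))\<^sup>+"
    using left right by (meson trancl_trans)
qed

lemma components_append:
  assumes G: "product_complex G" and L: "product_complex L"
  shows "components (G @ L) = (\<lambda>(C, D). cell_prod C D) ` (components G \<times> components L)"
proof -
  have "(incidence (G @ L))\<^sup>+ `` {x @ y} =
      cell_prod ((incidence G)\<^sup>+ `` {x}) ((incidence L)\<^sup>+ `` {y})"
    if xy: "x \<in> cells G" "y \<in> cells L" for x y
  proof (intro equalityI subsetI)
    fix z assume z: "z \<in> (incidence (G @ L))\<^sup>+ `` {x @ y}"
    then have "z \<in> cells (G @ L)" by (auto dest: connected_in_cells)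
    then obtain u v where "z = u @ v" "u \<in> cells G" "v \<in> cells L"
      by (auto simp: cells_append cell_prod_def)
    moreover from this have "(x, u) \<in> (incidence G)\<^sup>+" "(y, v) \<in> (incidence L)\<^sup>+"
      using z connected_append_iff[OF G L, of x u y v] xy by simp_all
    ultimately show "z \<in> cell_prod ((incidence G)\<^sup>+ `` {x}) ((incidence L)\<^sup>+ `` {y})"
      unfolding cell_prod_def by blast
  next
    fix z assume "z \<in> cell_prod ((incidence G)\<^sup>+ `` {x}) ((incidence L)\<^sup>+ `` {y})"
    then obtain u v where z: "z = u @ v" "(x, u) \<in> (incidence G)\<^sup>+" "(y, v) \<in> (incidence L)\<^sup>+"
      by (auto simp: cell_prod_def)
    moreover from this have "u \<in> cells G" "v \<in> cells L"
      by (auto dest: connected_in_cells)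
    ultimately show "z \<in> (incidence (G @ L))\<^sup>+ `` {x @ y}"
      using connected_append_iff[OF G L, of x u y v] xy by simp
  qed
  then have "(\<lambda>(x, y). (incidence (G @ L))\<^sup>+ `` {x @ y}) ` (cells G \<times> cells L) =
      (\<lambda>(x, y). cell_prod ((incidence G)\<^sup>+ `` {x}) ((incidence L)\<^sup>+ `` {y})) ` (cells G \<times> cells L)"
    by (intro image_cong) auto
  moreover have "components (G @ L) =
      (\<lambda>(x, y). (incidence (G @ L))\<^sup>+ `` {x @ y}) ` (cells G \<times> cells L)"
    unfolding components_eq_image cells_append[of G L]
    by (simp add: cell_prod_def[of "cells G" "cells L"] image_image case_prod_unfold)
  moreover have "components G \<times> components L =
      (\<lambda>(x, y). ((incidence G)\<^sup>+ `` {x}, (incidence L)\<^sup>+ `` {y})) ` (cells G \<times> cells L)"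
    unfolding components_eq_image by auto
  ultimately show ?thesis by (simp add: image_image case_prod_unfold)
qed

text \<open>
  Components are non-empty and disjoint, so a product of two of them determines its factors.
\<close>

lemma inj_cell_prod_components:
  "inj_on (\<lambda>(C, D). cell_prod C D) (components G \<times> components L)"
proof (rule inj_onI, clarify)
  fix C D C' D' assume *: "C \<in> components G" "D \<in> components L" "C' \<in> components G"
    "D' \<in> components L" and eq: "cell_prod C D = cell_prod C' D'"
  have "C \<noteq> {}" "D \<noteq> {}"
    using * by (simp_all add: component_nonempty)
  then obtain x y where xy: "x \<in> C" "y \<in> D" by blast
  have sub: "C \<subseteq> cells G" "D \<subseteq> cells L" "C' \<subseteq> cells G" "D' \<subseteq> cells L"
    using * by (simp_all add: component_subset)
  have "x @ y \<in> cell_prod C' D'" using xy eq[symmetric] by (auto simp: cell_prod_def)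
  then obtain x' y' where "x @ y = x' @ y'" "x' \<in> C'" "y' \<in> D'" by (auto simp: cell_prod_def)
  then have "x \<in> C'" "y \<in> D'" using xy sub by (metis append_eq_append_conv length_cell subsetD)+
  then show "C = C' \<and> D = D'"
    using * xy components_disjoint by blast
qed

lemma component_closed:
  assumes "C \<in> components G" "x \<in> C" "(x, y) \<in> incidence G"
  shows "y \<in> C"
  using in_quotient_imp_closed[OF equiv_connected, of C G x y] assms by (auto simp: components_def)

text \<open>
  For a single simplicial complex, a component is closed under passing to faces, hence is a
  subcomplex. The general case follows because components of a product are products of
  components.
\<close>

lemma component_is_product_complex:
  assumes "product_complex G" "C \<in> components G"
  shows "\<exists>D. product_complex D \<and> cells D = C"
  using assms
proof (induction G arbitrary: C)
  case Nil
  then show ?case by (simp add: product_complex_def)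
next
  case (Cons K G)
  have K: "simplicial_complex K" using Cons.prems(1) by (simp add: product_complex_def)
  have single: "\<exists>D. product_complex D \<and> cells D = C" if C: "C \<in> components [K]" for C
  \<comment> \<open>Cells of a one-factor product are singleton lists, so \<open>hd\<close> turns them back into simplices.\<close>
  proof (intro exI[of _ "[hd ` C]"] conjI)
    have cells1: "cells [A] = (\<lambda>s. [s]) ` A" for A :: "'a set set"
      by (auto simp: cells_def set_Cons_def)
    have sub: "C \<subseteq> (\<lambda>s. [s]) ` K"
      using component_subset[OF C] by (simp add: cells1)
    then have mem: "s \<in> hd ` C \<longleftrightarrow> [s] \<in> C" for s by force
    have "t \<in> hd ` C" if s: "s \<in> hd ` C" and t: "t \<subseteq> s" "t \<noteq> {}" for s t
    proof -
      have "s \<in> K" using s sub by auto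
      then have "t \<in> K" using K t unfolding simplicial_complex_def by blast
      then have "([s], [t]) \<in> incidence [K]"
        using \<open>s \<in> K\<close> t by (force simp: incidence_def cells1 set_Cons_def)
      then show ?thesis using component_closed[OF C] s mem by blast
    qed
    moreover have "hd ` C \<subseteq> K" using sub by auto
    ultimately have "simplicial_complex (hd ` C)"
      using K unfolding simplicial_complex_def by (meson finite_subset subsetD)
    then show "product_complex [hd ` C]" by (simp add: product_complex_def)
    show "cells [hd ` C] = C" using sub mem by (auto simp: cells1)
  qed
  show ?case
  proof (cases "G = []")
    case True
    then show ?thesis using single Cons.prems by simp
  next
    case False
    then have pc: "product_complex [K]" "product_complex G"
      using Cons.prems(1) by (auto simp: product_complex_def)
    have "C \<in> components ([K] @ G)" using Cons.prems(2) by simp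
    then obtain C1 C2 where C: "C = cell_prod C1 C2" "C1 \<in> components [K]" "C2 \<in> components G"
      unfolding components_append[OF pc] by auto
    obtain D1 D2 where "product_complex D1" "cells D1 = C1" "product_complex D2" "cells D2 = C2"
      using single[OF C(2)] Cons.IH[OF pc(2) C(3)] by blast
    then show ?thesis
      using C(1) by (metis cells_append product_complex_append)
  qed
qed

lemma finite_components: "product_complex G \<Longrightarrow> finite (components G)"
  by (simp add: components_eq_image finite_cells)

lemma ex_splitting:
  assumes "product_complex G"
  obtains Ds where "\<forall>D\<in>#Ds. product_complex D" "image_mset cells Ds = mset_set (components G)"
proof -
  obtain d where d: "\<And>C. C \<in> components G \<Longrightarrow> product_complex (d C) \<and> cells (d C) = C"
    using component_is_product_complex[OF assms] by metis
  show ?thesis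
  proof (rule that[of "image_mset d (mset_set (components G))"])
    have "image_mset (cells \<circ> d) (mset_set (components G)) = image_mset id (mset_set (components G))"
      by (rule image_mset_cong) (auto simp: d finite_components assms)
    then show "image_mset cells (image_mset d (mset_set (components G))) = mset_set (components G)"
      by (simp add: multiset.map_comp)
  qed (auto simp: d finite_components assms)
qed

text \<open>
  A path that starts in a component stays inside it, so a component is connected on its own.
\<close>

lemma components_of_component:
  assumes C: "cells D \<in> components G"
  shows "components D = {cells D}"
proof -
  have conn: "(x, y) \<in> (incidence D)\<^sup>+" if "(x, y) \<in> (incidence G)\<^sup>+" "x \<in> cells D" for x y
    using that
  proof (induction rule: trancl_induct)
    case (base y)
    then show ?case using component_closed[OF C, of x y] by (auto simp: incidence_def)
  next
    case (step y z)
    then have "(x, y) \<in> (incidence D)\<^sup>+" by blast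
    moreover from this have "y \<in> cells D"
      by (simp add: connected_in_cells)
    then have "(y, z) \<in> incidence D"
      using step.hyps(2) component_closed[OF C, of y z] by (auto simp: incidence_def)
    ultimately show ?case by (rule trancl_into_trancl)
  qed
  have "(incidence D)\<^sup>+ `` {x} = cells D" if x: "x \<in> cells D" for x
  proof
    show "(incidence D)\<^sup>+ `` {x} \<subseteq> cells D" by (auto dest: connected_in_cells)
    have "(x, y) \<in> (incidence G)\<^sup>+" if "y \<in> cells D" for y
      using in_quotient_imp_in_rel[OF equiv_connected, of "cells D" G x y] C x that
      by (simp add: components_def)
    then show "cells D \<subseteq> (incidence D)\<^sup>+ `` {x}" using conn x by blast
  qed
  moreover have "cells D \<noteq> {}" using C by (rule component_nonempty)
  ultimately show ?thesis unfolding components_eq_image by auto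
qed

text \<open>
  A meeting tuple lies in the component of any common face of its cells, and in no other
  component because it is non-empty; so the sum over meeting tuples splits.
\<close>

lemma wu_pc_splitting:
  assumes G: "product_complex G" and k: "k \<ge> 1"
    and Ds: "image_mset cells Ds = mset_set (components G)"
  shows "wu_pc k G = (\<Sum>D\<in>#Ds. wu_pc k D)"
proof -
  let ?T = "\<lambda>C. {xs. length xs = k \<and> set xs \<subseteq> C \<and> (\<Inter>x\<in>set xs. listset x) \<noteq> {}}"
  let ?w = "\<lambda>C. \<Sum>xs\<in>?T C. \<Prod>x\<leftarrow>xs. cell_sign x"
  have T: "wu_tuples k D = ?T (cells D)" for D :: "'a product_complex"
    by (simp add: wu_tuples_def)
  note sub = component_subset[of _ G]
  have "wu_tuples k G = (\<Union>C\<in>components G. ?T C)"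
  proof (intro equalityI subsetI)
    fix xs assume "xs \<in> wu_tuples k G"
    then have xs: "length xs = k" "set xs \<subseteq> cells G" "(\<Inter>x\<in>set xs. listset x) \<noteq> {}"
      by (auto simp: wu_tuples_def)
    then have "xs \<noteq> []" using k by auto
    then obtain y where y: "y \<in> cells G" "\<forall>x\<in>set xs. listset y \<subseteq> listset x"
      using meet_iff_common_face[OF G xs(2)] xs(3) by blast
    let ?C = "(incidence G)\<^sup>+ `` {y}"
    have "?C \<in> components G" using y(1) by (simp add: components_eq_image)
    moreover have "set xs \<subseteq> ?C" using y xs(2) by (auto simp: incidence_def)
    ultimately show "xs \<in> (\<Union>C\<in>components G. ?T C)" using xs by blast
  next
    fix xs assume "xs \<in> (\<Union>C\<in>components G. ?T C)"
    then show "xs \<in> wu_tuples k G" using sub unfolding wu_tuples_def by blast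
  qed
  moreover have "?T C \<inter> ?T C' = {}" if "C \<in> components G" "C' \<in> components G" "C \<noteq> C'" for C C'
  proof -
    have "C \<inter> C' = {}" using that by (rule components_disjoint)
    moreover have "set xs \<noteq> {}" if "length xs = k" for xs :: "'a cell list" using that k by auto
    ultimately have "\<not> (set xs \<subseteq> C \<and> set xs \<subseteq> C')" if "length xs = k" for xs
      using that by (metis Int_greatest subset_empty)
    then show ?thesis by blast
  qed
  moreover have "finite (?T C)" if "C \<in> components G" for C
  proof -
    have "finite {xs. set xs \<subseteq> C \<and> length xs = k}"
      using finite_subset[OF sub[OF that] finite_cells[OF G]] by (rule finite_lists_length_eq)
    then show ?thesis by (rule rev_finite_subset) auto
  qed
  ultimately have "wu_pc k G = (\<Sum>C\<in>components G. ?w C)"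
    unfolding wu_pc_def using finite_components[OF G] by (simp add: sum.UNION_disjoint)
  also have "\<dots> = (\<Sum>C\<in>#image_mset cells Ds. ?w C)"
    unfolding Ds by (simp add: sum_unfold_sum_mset)
  also have "\<dots> = (\<Sum>D\<in>#Ds. wu_pc k D)"
    by (simp add: multiset.map_comp comp_def wu_pc_def T)
  finally show ?thesis .
qed

section \<open>Isomorphisms between products\<close>

text \<open>
  Cells of products are naturally parametrized by pairs of cells. Comparing two complexes over
  a common parameter set avoids decomposing concatenated lists.
\<close>

lemma pc_iso_parametrized:
  assumes g: "bij_betw g I (cells G)" and h: "bij_betw h I (cells H)"
    and incl: "\<And>i j. i \<in> I \<Longrightarrow> j \<in> I \<Longrightarrow>
      listset (g i) \<subseteq> listset (g j) \<longleftrightarrow> listset (h i) \<subseteq> listset (h j)"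
  shows "pc_iso G H"
  unfolding pc_iso_def
proof (intro exI conjI ballI)
  let ?g' = "inv_into I g"
  show "bij_betw (h \<circ> ?g') (cells G) (cells H)"
    using bij_betw_trans[OF bij_betw_inv_into[OF g] h] .
  fix x y assume "x \<in> cells G" "y \<in> cells G"
  then have "?g' x \<in> I" "?g' y \<in> I" "g (?g' x) = x" "g (?g' y) = y"
    using g by (auto simp: bij_betw_def inv_into_into f_inv_into_f)
  then show "listset x \<subseteq> listset y \<longleftrightarrow> listset ((h \<circ> ?g') x) \<subseteq> listset ((h \<circ> ?g') y)"
    using incl[of "?g' x" "?g' y"] by simp
qed

lemma pc_iso_append_left:
  assumes G: "product_complex G" and H: "product_complex H" and L: "product_complex L"
    and "pc_iso G H"
  shows "pc_iso (G @ L) (H @ L)"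
proof -
  obtain f where f: "bij_betw f (cells G) (cells H)"
    and incl: "\<And>x y. x \<in> cells G \<Longrightarrow> y \<in> cells G \<Longrightarrow>
      listset x \<subseteq> listset y \<longleftrightarrow> listset (f x) \<subseteq> listset (f y)"
    using assms(4) unfolding pc_iso_def by blast
  have fH: "f x \<in> cells H" if "x \<in> cells G" for x using f that by (auto simp: bij_betw_def)
  show ?thesis
  proof (rule pc_iso_parametrized)
    show "bij_betw (\<lambda>(x, y). x @ y) (cells G \<times> cells L) (cells (G @ L))"
      by (rule bij_betw_append_cells)
    show "bij_betw ((\<lambda>(x, y). x @ y) \<circ> map_prod f id) (cells G \<times> cells L) (cells (H @ L))"
      using bij_betw_trans[OF bij_betw_map_prod[OF f bij_betw_id] bij_betw_append_cells] .
    show "listset (case p of (x, y) \<Rightarrow> x @ y) \<subseteq> listset (case q of (x, y) \<Rightarrow> x @ y) \<longleftrightarrow>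
        listset (((\<lambda>(x, y). x @ y) \<circ> map_prod f id) p) \<subseteq>
        listset (((\<lambda>(x, y). x @ y) \<circ> map_prod f id) q)"
      if "p \<in> cells G \<times> cells L" "q \<in> cells G \<times> cells L" for p q
      using that
      by (elim SigmaE) (simp add: incl fH append_cell_subset_iff[OF G L] append_cell_subset_iff[OF H L])
  qed
qed

lemma pc_iso_append_commute:
  assumes G: "product_complex G" and H: "product_complex H"
  shows "pc_iso (G @ H) (H @ G)"
proof (rule pc_iso_parametrized)
  show "bij_betw (\<lambda>(x, y). x @ y) (cells G \<times> cells H) (cells (G @ H))"
    by (rule bij_betw_append_cells)
  show "bij_betw ((\<lambda>(x, y). x @ y) \<circ> prod.swap) (cells G \<times> cells H) (cells (H @ G))"
    by (rule bij_betw_trans[OF _ bij_betw_append_cells]) (auto simp: bij_betw_def product_swap)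
  show "listset (case p of (x, y) \<Rightarrow> x @ y) \<subseteq> listset (case q of (x, y) \<Rightarrow> x @ y) \<longleftrightarrow>
      listset (((\<lambda>(x, y). x @ y) \<circ> prod.swap) p) \<subseteq> listset (((\<lambda>(x, y). x @ y) \<circ> prod.swap) q)"
    if "p \<in> cells G \<times> cells H" "q \<in> cells G \<times> cells H" for p q
    using that
    by (elim SigmaE) (simp add: append_cell_subset_iff[OF G H] append_cell_subset_iff[OF H G] conj_commute)
qed

lemma product_complex_one_point: "product_complex one_point"
  by (auto simp: product_complex_def one_point_def simplicial_complex_def subset_singleton_iff)

lemma cells_one_point: "cells one_point = {[{undefined}]}"
  by (auto simp: cells_def one_point_def set_Cons_def)

lemma pc_iso_one_point_append:
  assumes G: "product_complex G"
  shows "pc_iso (one_point @ G) G"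
proof (rule pc_iso_parametrized)
  show "bij_betw (\<lambda>(x, y). x @ y) (cells one_point \<times> cells G) (cells (one_point @ G))"
    by (rule bij_betw_append_cells)
  show "bij_betw snd (cells one_point \<times> cells G) (cells G)"
    by (auto simp: bij_betw_def inj_on_def cells_one_point)
  show "listset (case p of (x, y) \<Rightarrow> x @ y) \<subseteq> listset (case q of (x, y) \<Rightarrow> x @ y) \<longleftrightarrow>
      listset (snd p) \<subseteq> listset (snd q)"
    if "p \<in> cells one_point \<times> cells G" "q \<in> cells one_point \<times> cells G" for p q
    using that
    by (elim SigmaE) (simp add: append_cell_subset_iff[OF product_complex_one_point G]
        | simp add: cells_one_point)+
qed

section \<open>Strong equality is compatible with products\<close>

lemma signed_complexes_add_iff [simp]:
  "A + B \<in> signed_complexes \<longleftrightarrow> A \<in> signed_complexes \<and> B \<in> signed_complexes"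
  by (auto simp: signed_complexes_def)

lemma signed_complexes_empty [simp]: "{#} \<in> signed_complexes"
  by (simp add: signed_complexes_def)

lemma signed_complexes_single [simp]:
  "{#(s, G)#} \<in> signed_complexes \<longleftrightarrow> s \<in> {1, - 1} \<and> product_complex G"
  by (simp add: signed_complexes_def)

lemma signed_complexes_induct [consumes 1, case_names empty add]:
  assumes "A \<in> signed_complexes"
    and "P {#}"
    and "\<And>s G A. s \<in> {1, - 1} \<Longrightarrow> product_complex G \<Longrightarrow> A \<in> signed_complexes \<Longrightarrow> P A \<Longrightarrow>
      P ({#(s, G)#} + A)"
  shows "P A"
  using assms(1)
proof (induction A)
  case empty
  show ?case by (rule assms(2))
next
  case (add p A)
  then show ?case using assms(3)[of "fst p" "snd p" A] by (auto simp: signed_complexes_def)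
qed

lemma neg_sc_closed: "A \<in> signed_complexes \<Longrightarrow> neg_sc A \<in> signed_complexes"
  by (auto simp: signed_complexes_def neg_sc_def)

lemma mult_sc_empty_left [simp]: "mult_sc {#} B = {#}"
  by (simp add: mult_sc_def)

lemma mult_sc_add_left: "mult_sc (A + B) C = mult_sc A C + mult_sc B C"
  by (simp add: mult_sc_def)

lemma mult_sc_single_left: "mult_sc {#(s, G)#} B = image_mset (\<lambda>(t, H). (s * t, G @ H)) B"
  by (simp add: mult_sc_def)

lemma mult_sc_empty_right [simp]: "mult_sc A {#} = {#}"
  by (induction A) (auto simp: mult_sc_def)

lemma mult_sc_add_right: "mult_sc A (B + C) = mult_sc A B + mult_sc A C"
  by (induction A) (auto simp: mult_sc_def ac_simps)

lemma mult_sc_closed: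
  "A \<in> signed_complexes \<Longrightarrow> B \<in> signed_complexes \<Longrightarrow> mult_sc A B \<in> signed_complexes"
proof (induction A rule: signed_complexes_induct)
  case (add s G A)
  have "image_mset (\<lambda>(t, H). (s * t, G @ H)) B \<in> signed_complexes"
    using add by (auto simp: signed_complexes_def product_complex_append)
  then show ?case using add unfolding mult_sc_add_left mult_sc_single_left by simp
qed simp

lemma mult_sc_assoc: "mult_sc (mult_sc A B) C = mult_sc A (mult_sc B C)"
proof -
  have single: "mult_sc (image_mset (\<lambda>(t, H). (s * t, G @ H)) B) C =
      image_mset (\<lambda>(t, H). (s * t, G @ H)) (mult_sc B C)" for s and G :: "'a product_complex"
    by (induction B)
      (auto simp: mult_sc_def multiset.map_comp comp_def case_prod_unfold mult.assoc)
  show ?thesis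
  proof (induction A)
    case (add p A)
    obtain s G where p: "p = (s, G)" by fastforce
    have "mult_sc (mult_sc ({#p#} + A) B) C =
        mult_sc (mult_sc {#p#} B) C + mult_sc (mult_sc A B) C"
      by (simp only: mult_sc_add_left)
    also have "\<dots> = mult_sc ({#p#} + A) (mult_sc B C)"
      using add by (simp only: mult_sc_add_left mult_sc_single_left p single)
    finally show ?case by simp
  qed simp
qed

lemma neg_sc_mult: "neg_sc (mult_sc A B) = mult_sc (neg_sc A) B"
proof -
  have "neg_sc (image_mset (\<lambda>(t, H). (s * t, G @ H)) B) =
      image_mset (\<lambda>(t, H). (- s * t, G @ H)) B" for s and G :: "'a product_complex"
    by (simp add: neg_sc_def multiset.map_comp comp_def case_prod_unfold)
  then show ?thesis
    by (induction A) (auto simp: mult_sc_def neg_sc_def)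
qed

lemma strong_eq_closed:
  "strong_eq A B \<Longrightarrow> A \<in> signed_complexes \<and> B \<in> signed_complexes"
proof (induction rule: strong_eq.induct)
  case (split s G Ds)
  then show ?case by (auto simp: signed_complexes_def)
qed (auto simp: neg_sc_closed)

lemma strong_eq_add:
  assumes "strong_eq A A'" "strong_eq B B'"
  shows "strong_eq (A + B) (A' + B')"
proof -
  have "strong_eq (A + B) (A' + B)"
    using assms strong_eq_closed by (blast intro: strong_eq.add)
  moreover have "strong_eq (B + A') (B' + A')"
    using assms strong_eq_closed by (blast intro: strong_eq.add)
  ultimately show ?thesis by (metis strong_eq.trans add.commute)
qed

lemma strong_eq_sum:
  assumes "\<And>x. x \<in># M \<Longrightarrow> strong_eq (f x) (g x)"
  shows "strong_eq (\<Sum>x\<in>#M. f x) (\<Sum>x\<in>#M. g x)"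
  using assms by (induction M) (auto intro: strong_eq.refl strong_eq_add)

text \<open>
  The complexes \<open>G @ H\<close> and \<open>H @ G\<close> differ as lists and are only isomorphic, so products
  commute only up to strong equality.
\<close>

lemma mult_sc_commute:
  assumes "A \<in> signed_complexes" "B \<in> signed_complexes"
  shows "strong_eq (mult_sc A B) (mult_sc B A)"
  using assms
proof (induction A rule: signed_complexes_induct)
  case empty
  then show ?case by (simp add: strong_eq.refl)
next
  case (add s G A)
  have "strong_eq (mult_sc {#(s, G)#} B) (mult_sc B {#(s, G)#})"
    using add.prems
  proof (induction B rule: signed_complexes_induct)
    case empty
    then show ?case by (simp add: strong_eq.refl)
  next
    case (add t H B)
    have "strong_eq {#(s * t, G @ H)#} {#(s * t, H @ G)#}"
      using \<open>s \<in> {1, - 1}\<close> \<open>product_complex G\<close> add.hyps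
      by (intro strong_eq.iso product_complex_append pc_iso_append_commute) auto
    then have "strong_eq (mult_sc {#(s, G)#} {#(t, H)#}) (mult_sc {#(t, H)#} {#(s, G)#})"
      by (simp add: mult_sc_single_left mult.commute)
    then show ?case
      using add.IH by (simp only: mult_sc_add_left mult_sc_add_right) (rule strong_eq_add)
  qed
  then show ?case
    using add.IH[OF add.prems] by (simp only: mult_sc_add_left mult_sc_add_right) (rule strong_eq_add)
qed

lemma sum_mset_set_disjoint:
  assumes "finite I" and "\<And>i. i \<in> I \<Longrightarrow> finite (A i)"
    and "\<And>i j. i \<in> I \<Longrightarrow> j \<in> I \<Longrightarrow> i \<noteq> j \<Longrightarrow> A i \<inter> A j = {}"
  shows "(\<Sum>i\<in>I. mset_set (A i)) = mset_set (\<Union>i\<in>I. A i)"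
  using assms
proof (induction I rule: finite_induct)
  case (insert i I)
  then have "A i \<inter> (\<Union>j\<in>I. A j) = {}" by fastforce
  then show ?case using insert by (simp add: mset_set_Union)
qed simp

lemma image_mset_sum_mset:
  "image_mset f (\<Sum>x\<in>#M. g x) = (\<Sum>x\<in>#M. image_mset f (g x))"
  by (induction M) auto

text \<open>
  Let \<open>E D\<close> be the components of \<open>D \<times> L\<close>. Because \<open>D\<close> is connected, these are the products of
  \<open>D\<close> with the components of \<open>L\<close>; as \<open>D\<close> varies they run through all components of \<open>G \<times> L\<close>, each
  exactly once. So the sum of all \<open>E D\<close> splits both \<open>G \<times> L\<close> and the sum of the \<open>D \<times> L\<close>.
\<close>

lemma splitting_append:
  assumes G: "product_complex G" and L: "product_complex L" and s: "s \<in> {1, - 1}"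
    and Ds: "\<forall>D\<in>#Ds. product_complex D" "image_mset cells Ds = mset_set (components G)"
  shows "strong_eq {#(s, G @ L)#} {#(s, D @ L). D \<in># Ds#}"
proof -
  have fin: "finite (components G)" "finite (components L)"
    using G L by (simp_all add: finite_components)
  have "\<exists>Es. (\<forall>E\<in>#Es. product_complex E) \<and> image_mset cells Es = mset_set (components (D @ L))"
    if "D \<in># Ds" for D
    using ex_splitting[OF product_complex_append[OF _ L]] Ds(1) that by metis
  then obtain E where E: "\<And>D. D \<in># Ds \<Longrightarrow> \<forall>F\<in>#E D. product_complex F"
      "\<And>D. D \<in># Ds \<Longrightarrow> image_mset cells (E D) = mset_set (components (D @ L))"
    by metis
  have comp: "components (D @ L) = cell_prod (cells D) ` components L" if "D \<in># Ds" for D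
  proof -
    have "cells D \<in># mset_set (components G)"
      using that unfolding Ds(2)[symmetric] by simp
    then have "components D = {cells D}"
      using fin by (intro components_of_component) simp
    then show ?thesis
      using that Ds(1) L by (simp add: components_append image_image insert_Times_insert)
        (auto simp: image_iff)
  qed
  have components_append_disjoint:
    "cell_prod C ` components L \<inter> cell_prod C' ` components L = {}"
    if "C \<in> components G" "C' \<in> components G" "C \<noteq> C'" for C C'
    using inj_cell_prod_components[of G L] that unfolding inj_on_def by fastforce
  have "image_mset cells (\<Sum>D\<in>#Ds. E D) = (\<Sum>D\<in>#Ds. mset_set (cell_prod (cells D) ` components L))"
    by (simp add: image_mset_sum_mset multiset.map_comp comp_def E(2) comp cong: image_mset_cong)
  also have "\<dots> = (\<Sum>C\<in>#image_mset cells Ds. mset_set (cell_prod C ` components L))"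
    by (simp add: multiset.map_comp comp_def)
  also have "\<dots> = (\<Sum>C\<in>components G. mset_set (cell_prod C ` components L))"
    by (simp add: Ds(2) sum_unfold_sum_mset)
  also have "\<dots> = mset_set (\<Union>C\<in>components G. cell_prod C ` components L)"
    using fin components_append_disjoint by (intro sum_mset_set_disjoint) auto
  also have "(\<Union>C\<in>components G. cell_prod C ` components L) = components (G @ L)"
    by (auto simp: components_append[OF G L])
  finally have cells_E: "image_mset cells (\<Sum>D\<in>#Ds. E D) = mset_set (components (G @ L))" .
  have "strong_eq {#(s, G @ L)#} (image_mset (Pair s) (\<Sum>D\<in>#Ds. E D))"
    by (rule strong_eq.split[OF s product_complex_append[OF G L] _ cells_E]) (use E(1) in auto)
  moreover have "strong_eq (\<Sum>D\<in>#Ds. image_mset (Pair s) (E D)) (\<Sum>D\<in>#Ds. {#(s, D @ L)#})"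
  proof (rule strong_eq_sum)
    fix D assume D: "D \<in># Ds"
    have "strong_eq {#(s, D @ L)#} (image_mset (Pair s) (E D))"
      by (rule strong_eq.split[OF s product_complex_append[OF _ L] E(1)[OF D] E(2)[OF D]])
        (use Ds(1) D in blast)
    then show "strong_eq (image_mset (Pair s) (E D)) {#(s, D @ L)#}" by (rule strong_eq.sym)
  qed
  moreover have "(\<Sum>D\<in>#Ds. {#(s, D @ L)#}) = {#(s, D @ L). D \<in># Ds#}"
    by (induction Ds) auto
  ultimately show ?thesis unfolding image_mset_sum_mset by (simp only:) (rule strong_eq.trans)
qed

lemma mult_sc_cong_leftI:
  assumes "\<And>t L. t \<in> {1, - 1} \<Longrightarrow> product_complex L \<Longrightarrow>
      strong_eq (mult_sc A {#(t, L)#}) (mult_sc B {#(t, L)#})"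
    and "C \<in> signed_complexes"
  shows "strong_eq (mult_sc A C) (mult_sc B C)"
  using assms(2)
proof (induction C rule: signed_complexes_induct)
  case (add t L C)
  then show ?case unfolding mult_sc_add_right by (intro strong_eq_add assms(1))
qed (simp add: strong_eq.refl)

text \<open>
  Induction on the derivation: isomorphisms and splittings are multiplied by one summand at a
  time, and the other rules are formal consequences of bilinearity.
\<close>

lemma mult_sc_cong_left:
  assumes "strong_eq A B" "C \<in> signed_complexes"
  shows "strong_eq (mult_sc A C) (mult_sc B C)"
  using assms
proof (induction rule: strong_eq.induct)
  case (refl A)
  then show ?case by (simp add: strong_eq.refl mult_sc_closed)
next
  case (add A B D)
  then show ?case by (simp add: mult_sc_add_left strong_eq.add mult_sc_closed)
next
  case (iso s G H)
  have "strong_eq (mult_sc {#(s, G)#} {#(t, L)#}) (mult_sc {#(s, H)#} {#(t, L)#})"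
    if "t \<in> {1, - 1}" "product_complex L" for t L
  proof -
    have "strong_eq {#(s * t, G @ L)#} {#(s * t, H @ L)#}"
      using iso that by (intro strong_eq.iso product_complex_append pc_iso_append_left) auto
    then show ?thesis by (simp add: mult_sc_single_left)
  qed
  then show ?case using iso.prems by (rule mult_sc_cong_leftI)
next
  case (split s G Ds)
  have "strong_eq (mult_sc {#(s, G)#} {#(t, L)#}) (mult_sc (image_mset (Pair s) Ds) {#(t, L)#})"
    if "t \<in> {1, - 1}" "product_complex L" for t L
  proof -
    have "mult_sc (image_mset (Pair s) Ds) {#(t, L)#} = {#(s * t, D @ L). D \<in># Ds#}"
      by (induction Ds) (auto simp: mult_sc_def)
    moreover have "strong_eq {#(s * t, G @ L)#} {#(s * t, D @ L). D \<in># Ds#}"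
      using split that by (intro splitting_append) auto
    ultimately show ?thesis by (simp add: mult_sc_single_left)
  qed
  then show ?case using split.prems by (rule mult_sc_cong_leftI)
next
  case (cancel A)
  then show ?case
    using strong_eq.cancel[OF mult_sc_closed[of A C]] by (simp add: mult_sc_add_left neg_sc_mult)
qed (blast intro: strong_eq.sym strong_eq.trans)+

lemma mult_sc_cong:
  assumes "strong_eq A A'" "strong_eq B B'"
  shows "strong_eq (mult_sc A B) (mult_sc A' B')"
proof -
  have "A' \<in> signed_complexes" "B \<in> signed_complexes" "B' \<in> signed_complexes"
    using assms strong_eq_closed by blast+
  then show ?thesis
    by (meson assms mult_sc_commute mult_sc_cong_left strong_eq.trans)
qed

section \<open>The strong ring is a commutative ring\<close>

lemma equiv_strong_rel: "equiv signed_complexes strong_rel"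
proof (rule equivI)
  show "strong_rel \<subseteq> signed_complexes \<times> signed_complexes"
    by (auto simp: strong_rel_def dest: strong_eq_closed)
  show "refl_on signed_complexes strong_rel"
    by (rule refl_onI) (simp add: strong_rel_def strong_eq.refl)
  show "sym strong_rel" unfolding strong_rel_def by (rule symI) (simp add: strong_eq.sym)
  show "trans strong_rel" unfolding strong_rel_def by (rule transI) (simp, erule (1) strong_eq.trans)
qed

lemma strong_class_eqI: "strong_eq A B \<Longrightarrow> strong_class A = strong_class B"
  unfolding strong_class_def
  by (rule equiv_class_eq[OF equiv_strong_rel]) (simp add: strong_rel_def)

lemma carrier_strong_ring:
  "carrier strong_ring = strong_class ` signed_complexes"
  by (auto simp: strong_ring_def quotient_def strong_class_def)

lemma add_strong_class:
  assumes "A \<in> signed_complexes" "B \<in> signed_complexes"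
  shows "strong_class A \<oplus>\<^bsub>strong_ring\<^esub> strong_class B = strong_class (A + B)"
proof -
  have "(\<lambda>A B. strong_class (A + B)) respects2 strong_rel"
    by (rule congruent2I') (simp add: strong_rel_def strong_class_eqI strong_eq_add)
  from UN_equiv_class2[OF equiv_strong_rel equiv_strong_rel this assms]
  show ?thesis by (simp add: strong_ring_def strong_class_def)
qed

lemma mult_strong_class:
  assumes "A \<in> signed_complexes" "B \<in> signed_complexes"
  shows "strong_class A \<otimes>\<^bsub>strong_ring\<^esub> strong_class B = strong_class (mult_sc A B)"
proof -
  have "(\<lambda>A B. strong_class (mult_sc A B)) respects2 strong_rel"
    by (rule congruent2I') (simp add: strong_rel_def strong_class_eqI mult_sc_cong)
  from UN_equiv_class2[OF equiv_strong_rel equiv_strong_rel this assms]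
  show ?thesis by (simp add: strong_ring_def strong_class_def)
qed

lemma one_strong_ring: "\<one>\<^bsub>strong_ring\<^esub> = strong_class {#(1, one_point)#}"
  and zero_strong_ring: "\<zero>\<^bsub>strong_ring\<^esub> = strong_class {#}"
  by (simp_all add: strong_ring_def)

lemma mult_sc_one_left:
  assumes "A \<in> signed_complexes"
  shows "strong_eq (mult_sc {#(1, one_point)#} A) A"
  using assms
proof (induction A rule: signed_complexes_induct)
  case (add s G A)
  have "strong_eq (mult_sc {#(1, one_point)#} {#(s, G)#}) {#(s, G)#}"
    unfolding mult_sc_single_left image_mset_single prod.case mult_1
    using add.hyps(1,2)
    by (intro strong_eq.iso product_complex_append product_complex_one_point
        pc_iso_one_point_append)
  then show ?case unfolding mult_sc_add_right using add.IH by (rule strong_eq_add)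
qed (simp add: strong_eq.refl)

lemma cring_strong_ring: "cring (strong_ring :: 'a signed_complex set ring)"
proof (rule cringI)
  note cls = carrier_strong_ring zero_strong_ring one_strong_ring
    add_strong_class mult_strong_class mult_sc_closed product_complex_one_point
  show "abelian_group (strong_ring :: 'a signed_complex set ring)"
  proof (rule abelian_groupI)
    fix X :: "'a signed_complex set" assume "X \<in> carrier strong_ring"
    then obtain A where A: "A \<in> signed_complexes" "X = strong_class A"
      by (auto simp: carrier_strong_ring)
    show "\<exists>Y\<in>carrier strong_ring. Y \<oplus>\<^bsub>strong_ring\<^esub> X = \<zero>\<^bsub>strong_ring\<^esub>"
    proof (rule bexI)
      show "strong_class (neg_sc A) \<oplus>\<^bsub>strong_ring\<^esub> X = \<zero>\<^bsub>strong_ring\<^esub>"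
        using strong_class_eqI[OF strong_eq.cancel[OF A(1)]]
        by (simp add: A cls neg_sc_closed add.commute)
    qed (simp add: A carrier_strong_ring neg_sc_closed)
  qed (auto simp: carrier_strong_ring zero_strong_ring add_strong_class ac_simps)
  show "comm_monoid (strong_ring :: 'a signed_complex set ring)"
  proof (rule comm_monoidI)
    fix X Y :: "'a signed_complex set"
    assume "X \<in> carrier strong_ring" "Y \<in> carrier strong_ring"
    then obtain A B where AB: "A \<in> signed_complexes" "X = strong_class A"
        "B \<in> signed_complexes" "Y = strong_class B"
      by (auto simp: carrier_strong_ring)
    show "X \<otimes>\<^bsub>strong_ring\<^esub> Y = Y \<otimes>\<^bsub>strong_ring\<^esub> X"
      using strong_class_eqI[OF mult_sc_commute[OF AB(1,3)]] by (simp add: AB mult_strong_class)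
  qed (auto simp: cls mult_sc_assoc strong_class_eqI[OF mult_sc_one_left])
qed (auto simp: carrier_strong_ring add_strong_class mult_strong_class mult_sc_closed
    mult_sc_add_left)

section \<open>The Wu characteristic as a ring homomorphism\<close>

lemma wu_empty [simp]: "wu k {#} = 0"
  by (simp add: wu_def)

lemma wu_add: "wu k (A + B) = wu k A + wu k B"
  by (simp add: wu_def)

lemma wu_single: "wu k {#(s, G)#} = s * wu_pc k G"
  by (simp add: wu_def)

lemma wu_neg: "wu k (neg_sc A) = - wu k A"
  by (induction A) (auto simp: wu_def neg_sc_def)

lemma wu_mult: "wu k (mult_sc A B) = wu k A * wu k B"
proof -
  have "wu k (image_mset (\<lambda>(t, H). (s * t, G @ H)) B) = s * wu_pc k G * wu k B"
    for s and G :: "'a product_complex"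
    by (induction B) (auto simp: wu_def wu_pc_append algebra_simps)
  then show ?thesis
    by (induction A) (auto simp: wu_def mult_sc_def algebra_simps)
qed

lemma wu_one_point: "wu_pc k one_point = 1"
proof -
  have "wu_tuples k one_point = {replicate k [{undefined :: 'a}]}"
  proof -
    have "{xs. length xs = k \<and> set xs \<subseteq> {x}} = {replicate k x}" for x :: "'a cell"
      by (auto simp: subset_singleton_iff intro: replicate_eqI)
    moreover have "[undefined :: 'a] \<in> (\<Inter>x\<in>set xs. listset x)" if "set xs \<subseteq> {[{undefined}]}" for xs
      using that by (auto simp: set_Cons_def)
    ultimately show ?thesis unfolding wu_tuples_def cells_one_point by blast
  qed
  moreover have "cell_sign [{undefined :: 'a}] = 1"
    by (simp add: cell_sign_def cell_dim_def)
  ultimately show ?thesis by (simp add: wu_pc_def prod_list_replicate)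
qed

text \<open>
  Each generating relation of the strong ring preserves \<open>\<omega>\<^sub>k\<close>: isomorphism by \<open>wu_pc_iso\<close>,
  splitting by \<open>wu_pc_splitting\<close>, and cancellation because negation reverses signs.
\<close>

lemma wu_strong_eq:
  assumes "k \<ge> 1" "strong_eq A B"
  shows "wu k A = wu k B"
  using assms(2)
proof (induction rule: strong_eq.induct)
  case (iso s G H)
  then show ?case using wu_pc_iso[of G H k, OF _ _ _ assms(1)] by (simp add: wu_single)
next
  case (split s G Ds)
  have "wu k (image_mset (Pair s) Ds) = s * (\<Sum>D\<in>#Ds. wu_pc k D)"
    by (simp add: wu_def multiset.map_comp comp_def sum_mset_distrib_left)
  moreover have "wu_pc k G = (\<Sum>D\<in>#Ds. wu_pc k D)"
    by (rule wu_pc_splitting) fact+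
  ultimately show ?case by (simp only: wu_single)
qed (simp_all add: wu_add wu_neg)

lemma wu_class_strong_class:
  assumes "k \<ge> 1" "A \<in> signed_complexes"
  shows "wu_class k (strong_class A) = wu k A"
proof -
  have mem: "B \<in> strong_class A \<longleftrightarrow> strong_eq A B" for B
    by (simp add: strong_class_def strong_rel_def)
  have "strong_class A \<noteq> {}" using strong_eq.refl[OF assms(2)] mem by blast
  moreover have "wu k B = wu k A" if "B \<in> strong_class A" for B
    using that wu_strong_eq[OF assms(1), of A B] by (simp add: mem)
  ultimately show ?thesis unfolding wu_class_def by (rule the_elem_image_unique)
qed

theorem proposition2:
  fixes k :: nat
  assumes "k \<ge> 1"
  shows "ring_hom_cring (strong_ring :: 'a signed_complex set ring) \<Z> (wu_class k)
       \<and> (\<forall>A \<in> (signed_complexes :: 'a signed_complex set). wu_class k (strong_class A) = wu k A)"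
proof
  have "wu_class k \<in> ring_hom (strong_ring :: 'a signed_complex set ring) \<Z>"
    by (rule ring_hom_memI)
      (auto simp: carrier_strong_ring add_strong_class mult_strong_class one_strong_ring
        wu_class_strong_class[OF assms] mult_sc_closed wu_add wu_mult wu_single
        product_complex_one_point wu_one_point)
  then show "ring_hom_cring (strong_ring :: 'a signed_complex set ring) \<Z> (wu_class k)"
    by (intro ring_hom_cring.intro ring_hom_cring_axioms.intro cring_strong_ring int_is_cring)
qed (simp add: wu_class_strong_class[OF assms])

end
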